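(* Let $d\ge 1$, let $K\subset\mathbb{R}^d$ be a (non-degenerate) simplex, and let $X=\{\mathbf{x}_1,\dots,\mathbf{x}_{d+1}\}\subset K$ be a set of degree one Fekete points for $K$. Then $X$ is the set of vertices of $K$, and the Lebesgue constant for degree one interpolation at $X$ satisfies $$\Lambda_1(X;K)=1 .$$
   Context: For points $\mathbf{x}_1,\dots,\mathbf{x}_{d+1}\in\mathbb{R}^d$, let $\mathrm{vdm}(\mathbf{x}_1,\dots,\mathbf{x}_{d+1})$ be the determinant of the $(d+1)\times(d+1)$ matrix whose $i$th row is $[1,\mathbf{x}_i^t]$ (the Vandermonde determinant for polynomials of degree at most one in the basis $\{1,x_1,\dots,x_d\}$). A set of $d+1$ distinct points of $K$ is a set of degree one Fekete points for $K$ if it maximizes $|\mathrm{vdm}|$ over $K^{d+1}$. When $\mathrm{vdm}(\mathbf{x}_1,\dots,\mathbf{x}_{d+1})\ne 0$, the fundamental Lagrange polynomials $\ell_1,\dots,\ell_{d+1}$ are the unique polynomials of degree at most one on $\mathbb{R}^d$ with $\ell_i(\mathbf{x}_j)=\delta_{ij}$, and the Lebesgue constant is $\Lambda_1(X;K):=\max_{\mathbf{x}\in K}\sum_{i=1}^{d+1}|\ell_i(\mathbf{x})|$. *)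

theory Defs
  imports "HOL-Analysis.Analysis"
begin

text \<open>
  The dimension is \<open>d = CARD('n)\<close>. The \<open>d + 1\<close> points are indexed by \<open>'n option\<close>, which has
  exactly \<open>d + 1\<close> elements and also indexes the basis \<open>{1, x\<^sub>1, \<dots>, x\<^sub>d}\<close>: \<open>None\<close> stands for
  the constant polynomial and \<open>Some k\<close> for the \<open>k\<close>-th coordinate.
\<close>

definition vdm :: "('n::finite option \<Rightarrow> real ^ 'n) \<Rightarrow> real" where
  "vdm x = det ((\<chi> i j. case j of None \<Rightarrow> 1 | Some k \<Rightarrow> x i $ k) :: real ^ 'n option ^ 'n option)"

definition fekete_points :: "('n::finite option \<Rightarrow> real ^ 'n) \<Rightarrow> (real ^ 'n) set \<Rightarrow> bool" where
  "fekete_points x K \<longleftrightarrow>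
     inj x \<and> range x \<subseteq> K \<and> (\<forall>y. range y \<subseteq> K \<longrightarrow> \<bar>vdm y\<bar> \<le> \<bar>vdm x\<bar>)"

definition poly_deg_le_one :: "(real ^ 'n::finite \<Rightarrow> real) \<Rightarrow> bool" where
  "poly_deg_le_one p \<longleftrightarrow> (\<exists>c b. \<forall>z. p z = c + (\<Sum>k\<in>UNIV. b k * z $ k))"

text \<open>Only meaningful when \<open>vdm x \<noteq> 0\<close>, so that the polynomial exists and is unique.\<close>

definition lagrange_poly :: "('n::finite option \<Rightarrow> real ^ 'n) \<Rightarrow> 'n option \<Rightarrow> real ^ 'n \<Rightarrow> real" where
  "lagrange_poly x i =
     (THE p. poly_deg_le_one p \<and> (\<forall>j. p (x j) = (if i = j then 1 else 0)))"

text \<open>A maximum, not a supremum: the value is unspecified if no maximum is attained on \<open>K\<close>.\<close>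

definition lebesgue_constant :: "('n::finite option \<Rightarrow> real ^ 'n) \<Rightarrow> (real ^ 'n) set \<Rightarrow> real" where
  "lebesgue_constant x K =
     (GREATEST m. m \<in> (\<lambda>z. \<Sum>i\<in>UNIV. \<bar>lagrange_poly x i z\<bar>) ` K)"

end

theory Submission
  imports Defs
begin

text \<open>
  Since \<open>vdm\<close> is affine in each point, if a Fekete point \<open>x i\<close> is a convex combination of
  vertices, then replacing it by any vertex that carries positive weight keeps \<open>\<bar>vdm\<bar>\<close> maximal.
  If \<open>x i\<close> is not a vertex, two distinct vertices \<open>a\<close>, \<open>b\<close> carry positive weight. By induction on
  the number of non-vertices, both replacements yield configurations that run through all
  vertices exactly once, so the vertex missed by the other points is \<open>a\<close> as well as \<open>b\<close>, which is
  absurd. At the vertices the Lagrange polynomials are the barycentric coordinates, which are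
  nonnegative on the simplex and add up to 1.
\<close>

definition affine_row :: "real ^ 'n::finite \<Rightarrow> real ^ 'n option" where
  "affine_row z = (\<chi> j. case j of None \<Rightarrow> 1 | Some k \<Rightarrow> z $ k)"

lemma vdm_altdef: "vdm x = det (\<chi> i. affine_row (x i))"
  by (simp add: vdm_def affine_row_def)

text \<open>The constant coordinate \<open>None\<close> is where the weights have to sum to 1.
  Affine combinations of points thus become linear combinations of rows, to which multilinearity of
  \<open>det\<close> applies.\<close>

lemma affine_row_combination:
  assumes "sum u S = 1"
  shows "affine_row (\<Sum>v\<in>S. u v *\<^sub>R f v) = (\<Sum>v\<in>S. u v *s affine_row (f v))"
  using assms by (auto simp: affine_row_def vec_eq_iff split: option.split)

lemma vdm_fun_upd_combination:
  assumes "finite S" "sum u S = 1"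
  shows "vdm (x(i := \<Sum>v\<in>S. u v *\<^sub>R f v)) = (\<Sum>v\<in>S. u v * vdm (x(i := f v)))"
proof -
  have row: "vdm (x(i := z)) = det (\<chi> j. if j = i then affine_row z else affine_row (x j))" for z
    unfolding vdm_altdef by (rule arg_cong[of _ _ det]) (simp add: vec_eq_iff)
  show ?thesis
    unfolding row affine_row_combination[OF assms(2)]
    by (simp add: det_linear_row_sum[OF assms(1)] det_row_mul)
qed

lemma vdm_nonzero_imp_inj:
  assumes "vdm x \<noteq> 0"
  shows "inj x"
proof (rule injI, rule ccontr)
  fix i j assume "x i = x j" "i \<noteq> j"
  then have "vdm x = 0"
    unfolding vdm_altdef
    by (intro det_identical_rows[of i j]) (simp_all add: row_def)
  with assms show False by simp
qed

lemma sum_option: "(\<Sum>i\<in>(UNIV :: 'n::finite option set). f i) = f None + (\<Sum>k\<in>UNIV. f (Some k))"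
  by (simp add: UNIV_option_conv sum.reindex)

text \<open>A kernel vector of the transposed matrix is an affine dependence: its
  \<open>None\<close> equation says that the coefficients sum to 0, its \<open>Some\<close>
  equations that the weighted points do.\<close>

lemma vdm_nonzero_if_affine_independent:
  fixes x :: "'n::finite option \<Rightarrow> real ^ 'n"
  assumes "inj x" "\<not> affine_dependent (range x)"
  shows "vdm x \<noteq> 0"
proof
  let ?M = "\<chi> i. affine_row (x i)"
  assume "vdm x = 0"
  then have "\<not> invertible (transpose ?M)"
    by (simp add: vdm_altdef invertible_det_nz)
  then obtain c where c: "transpose ?M *v c = 0" "c \<noteq> 0"
    by (auto simp: invertible_left_inverse matrix_left_invertible_ker)
  have eq: "(\<Sum>i\<in>UNIV. affine_row (x i) $ j * c $ i) = 0" for j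
    using c(1) by (simp add: matrix_vector_mult_def transpose_def vec_eq_iff)
  \<comment> \<open>Affine dependence takes coefficients on points, not on indices; injectivity of
    \<open>x\<close> allows the transfer.\<close>
  define u where "u = (\<lambda>v. c $ inv x v)"
  have ux: "u (x i) = c $ i" for i
    using assms(1) by (simp add: u_def)
  have "sum u (range x) = 0"
    using eq[of None] by (simp add: sum.reindex[OF assms(1)] ux affine_row_def)
  moreover have "(\<Sum>v\<in>range x. u v *\<^sub>R v) = 0"
    using eq[of "Some _"]
    by (simp add: sum.reindex[OF assms(1)] ux affine_row_def vec_eq_iff mult.commute)
  moreover obtain i where "c $ i \<noteq> 0"
    using c(2) by (auto simp: vec_eq_iff)
  then have "\<exists>v\<in>range x. u v \<noteq> 0"
    using ux by auto
  ultimately have "affine_dependent (range x)"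
    by (subst affine_dependent_explicit_finite) auto
  with assms(2) show False by simp
qed

text \<open>A term of positive weight with absolute value below \<open>m\<close> would pull the
  average strictly below \<open>m\<close>.\<close>

lemma weighted_average_eq_bound:
  fixes u g :: "'a \<Rightarrow> real"
  assumes "finite S" and "\<And>v. v \<in> S \<Longrightarrow> 0 \<le> u v" and "sum u S = 1"
    and bound: "\<And>v. v \<in> S \<Longrightarrow> \<bar>g v\<bar> \<le> m" and avg: "m \<le> \<bar>\<Sum>v\<in>S. u v * g v\<bar>"
    and "a \<in> S" "u a > 0"
  shows "\<bar>g a\<bar> = m"
proof (rule ccontr)
  assume "\<bar>g a\<bar> \<noteq> m"
  with bound[OF \<open>a \<in> S\<close>] have "\<bar>g a\<bar> < m" by simp
  have "\<bar>\<Sum>v\<in>S. u v * g v\<bar> \<le> (\<Sum>v\<in>S. u v * \<bar>g v\<bar>)"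
    using sum_abs[of "\<lambda>v. u v * g v" S] assms(2) by (simp add: abs_mult)
  also have "\<dots> < (\<Sum>v\<in>S. u v * m)"
    using \<open>\<bar>g a\<bar> < m\<close> assms
    by (intro sum_strict_mono_ex1) (auto intro!: mult_left_mono bexI[of _ a])
  also have "\<dots> = m"
    using assms(3) by (simp flip: sum_distrib_right)
  finally show False using avg by simp
qed

text \<open>A single positive weight would have to be 1, and the combination would then be a point
  of \<open>S\<close>.\<close>

lemma convex_combination_two_positive:
  fixes S :: "'a::real_vector set"
  assumes "finite S" and nonneg: "\<And>v. v \<in> S \<Longrightarrow> 0 \<le> u v" and sum1: "sum u S = 1"
    and notin: "(\<Sum>v\<in>S. u v *\<^sub>R v) \<notin> S"
  obtains a b where "a \<in> S" "b \<in> S" "a \<noteq> b" "u a > 0" "u b > 0"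
proof -
  obtain a where a: "a \<in> S" "u a > 0"
    by (metis less_eq_real_def nonneg sum.neutral sum1 zero_neq_one)
  have "\<exists>b\<in>S - {a}. u b > 0"
  proof (rule ccontr)
    assume "\<not> ?thesis"
    with nonneg have 0: "\<And>b. b \<in> S - {a} \<Longrightarrow> u b = 0"
      by force
    have "u a = 1" "(\<Sum>v\<in>S. u v *\<^sub>R v) = u a *\<^sub>R a"
      using sum1 by (simp_all add: sum.remove[OF assms(1) a(1)] 0)
    with a notin show False by simp
  qed
  with a that show thesis by blast
qed

text \<open>Maximality and nonvanishing of \<open>vdm\<close> pass to the configurations obtained by
  a replacement, so the induction hypothesis applies to them; injectivity then comes from
  \<open>vdm_nonzero_imp_inj\<close>.\<close>

lemma maximal_vdm_imp_range_eq:
  fixes x :: "'n::finite option \<Rightarrow> real ^ 'n"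
  assumes "finite V" "card V = CARD('n option)"
    and "range x \<subseteq> convex hull V" "vdm x \<noteq> 0"
    and "\<And>y. range y \<subseteq> convex hull V \<Longrightarrow> \<bar>vdm y\<bar> \<le> \<bar>vdm x\<bar>"
  shows "range x = V"
  using assms(3-)
proof (induction "card {i. x i \<notin> V}" arbitrary: x rule: less_induct)
  case less
  note inj = vdm_nonzero_imp_inj[OF less.prems(2)]
  show ?case
  proof (cases "range x \<subseteq> V")
    case True
    then show ?thesis
      using assms(1,2) inj by (intro card_subset_eq) (simp_all add: card_image)
  next
    case False
    then obtain i where i: "x i \<notin> V" by auto
    have "x i \<in> convex hull V"
      using less.prems(1) by auto
    then obtain u where u: "\<And>v. v \<in> V \<Longrightarrow> 0 \<le> u v" "sum u V = 1" "(\<Sum>v\<in>V. u v *\<^sub>R v) = x i"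
      using assms(1) by (auto simp: convex_hull_finite)
    have in_hull: "range (x(i := a)) \<subseteq> convex hull V" if "a \<in> V" for a
      using that less.prems(1) hull_inc[of a V convex] by auto
    \<comment> \<open>By linearity in row \<open>i\<close>, \<open>vdm x\<close> is the
      \<open>u\<close>-average of the values \<open>vdm (x(i := v))\<close>, which maximality bounds
      by \<open>vdm x\<close> in absolute value.\<close>
    have vdm_upd: "\<bar>vdm (x(i := a))\<bar> = \<bar>vdm x\<bar>" if "a \<in> V" "u a > 0" for a
    proof (rule weighted_average_eq_bound[OF assms(1) u(1,2) _ _ that])
      have "vdm x = vdm (x(i := \<Sum>v\<in>V. u v *\<^sub>R v))"
        by (simp add: u(3))
      also have "\<dots> = (\<Sum>v\<in>V. u v * vdm (x(i := v)))"
        by (rule vdm_fun_upd_combination[OF assms(1) u(2)])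
      finally show "\<bar>vdm x\<bar> \<le> \<bar>\<Sum>v\<in>V. u v * vdm (x(i := v))\<bar>"
        by simp
    qed (use less.prems(3) in_hull in auto)
    have replace: "range (x(i := a)) = V" "inj (x(i := a))" if a: "a \<in> V" "u a > 0" for a
    proof -
      have "{j. (x(i := a)) j \<notin> V} \<subset> {j. x j \<notin> V}"
        using i a by auto
      then have "card {j. (x(i := a)) j \<notin> V} < card {j. x j \<notin> V}"
        by (intro psubset_card_mono) auto
      moreover have nz: "vdm (x(i := a)) \<noteq> 0"
        using vdm_upd[OF a] less.prems(2) by auto
      ultimately show "range (x(i := a)) = V"
        using less.prems(3) vdm_upd[OF a] in_hull[OF a(1)] by (intro less.hyps) auto
      show "inj (x(i := a))"
        by (rule vdm_nonzero_imp_inj[OF nz])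
    qed
    obtain a b where ab: "a \<in> V" "b \<in> V" "a \<noteq> b" "u a > 0" "u b > 0"
      using convex_combination_two_positive[OF assms(1) u(1,2)] i u(3) by metis
    \<comment> \<open>With \<open>b\<close> at place \<open>i\<close> the vertex \<open>a\<close>
      must occur at some other place \<open>j\<close>, so \<open>x j = a\<close> already; putting
      \<open>a\<close> at place \<open>i\<close> as well then contradicts injectivity.\<close>
    obtain j where j: "(x(i := b)) j = a"
      using replace(1)[OF ab(2,5)] ab(1) by (metis imageE)
    with ab(3) have "j \<noteq> i" by auto
    then have "(x(i := a)) j = (x(i := a)) i"
      using j by simp
    with replace(2)[OF ab(1,4)] \<open>j \<noteq> i\<close> show ?thesis
      by (meson injD)
  qed
qed

lemma poly_deg_le_one_combination:
  assumes "poly_deg_le_one p" "sum u S = 1"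
  shows "p (\<Sum>v\<in>S. u v *\<^sub>R f v) = (\<Sum>v\<in>S. u v * p (f v))"
proof -
  obtain c b where p: "\<And>z. p z = c + (\<Sum>k\<in>UNIV. b k * z $ k)"
    using assms(1) by (auto simp: poly_deg_le_one_def)
  have "(\<Sum>k\<in>UNIV. b k * (\<Sum>v\<in>S. u v *\<^sub>R f v) $ k)
      = (\<Sum>v\<in>S. u v * (\<Sum>k\<in>UNIV. b k * f v $ k))"
    by (simp add: sum_distrib_left mult.left_commute) (rule sum.swap)
  then show ?thesis
    using assms(2)
    by (simp add: p distrib_left sum.distrib flip: sum_distrib_right)
qed

text \<open>In terms of the coefficient vector \<open>w\<close>, evaluation at the nodes is
  multiplication by \<open>?M\<close>. The interpolation conditions are a linear system with
  invertible matrix, which yields the existence and uniqueness that \<open>THE\<close>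
  requires.\<close>

lemma lagrange_poly_properties:
  fixes x :: "'n::finite option \<Rightarrow> real ^ 'n"
  assumes "vdm x \<noteq> 0"
  shows "poly_deg_le_one (lagrange_poly x i)"
    and "lagrange_poly x i (x j) = (if i = j then 1 else 0)"
proof -
  let ?M = "\<chi> i. affine_row (x i)"
  let ?P = "\<lambda>p. poly_deg_le_one p \<and> (\<forall>j. p (x j) = (if i = j then 1 else 0))"
  define q where "q w z = w $ None + (\<Sum>k\<in>UNIV. w $ Some k * z $ k)"
    for w :: "real ^ 'n option" and z :: "real ^ 'n"
  have poly_iff: "poly_deg_le_one p \<longleftrightarrow> (\<exists>w. p = q w)" for p
  proof
    assume "poly_deg_le_one p"
    then obtain c b where "\<And>z. p z = c + (\<Sum>k\<in>UNIV. b k * z $ k)"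
      by (auto simp: poly_deg_le_one_def)
    then have "p = q (\<chi> j. case j of None \<Rightarrow> c | Some k \<Rightarrow> b k)"
      by (auto simp: q_def)
    then show "\<exists>w. p = q w" ..
  next
    assume "\<exists>w. p = q w"
    then obtain w where "p = q w" ..
    then show "poly_deg_le_one p"
      unfolding poly_deg_le_one_def q_def
      by (intro exI[of _ "w $ None"] exI[of _ "\<lambda>k. w $ Some k"]) simp
  qed
  have eval: "q w (x j) = (?M *v w) $ j" for w j
    by (simp add: q_def matrix_vector_mult_def affine_row_def sum_option mult.commute)
  have char: "(\<forall>j. q w (x j) = (if i = j then 1 else 0)) \<longleftrightarrow> ?M *v w = axis i 1" for w
    by (simp add: eval vec_eq_iff axis_def eq_commute[of i])
  have inv: "invertible ?M"
    using assms by (simp add: vdm_altdef invertible_det_nz)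
  then obtain B where B: "?M ** B = mat 1" "B ** ?M = mat 1"
    by (auto simp: invertible_def)
  have solve: "?M *v w = axis i 1 \<longleftrightarrow> w = B *v axis i 1" for w
    by (metis B matrix_vector_mul_assoc matrix_vector_mul_lid)
  have "?P (q (B *v axis i 1))"
    unfolding poly_iff char solve by blast
  moreover have "p = q (B *v axis i 1)" if "?P p" for p
  proof -
    obtain w where w: "p = q w"
      using \<open>?P p\<close> poly_iff by blast
    with \<open>?P p\<close> have "\<forall>j. q w (x j) = (if i = j then 1 else 0)"
      by simp
    then show ?thesis
      unfolding char solve w by simp
  qed
  ultimately have "?P (lagrange_poly x i)"
    unfolding lagrange_poly_def by (rule theI)
  then show "poly_deg_le_one (lagrange_poly x i)"
    and "lagrange_poly x i (x j) = (if i = j then 1 else 0)"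
    by auto
qed

lemma lebesgue_constant_simplex:
  fixes x :: "'n::finite option \<Rightarrow> real ^ 'n"
  assumes "vdm x \<noteq> 0"
  shows "lebesgue_constant x (convex hull (range x)) = 1"
proof -
  have "(\<Sum>i\<in>UNIV. \<bar>lagrange_poly x i z\<bar>) = 1" if z: "z \<in> convex hull (range x)" for z
  proof -
    note inj = vdm_nonzero_imp_inj[OF assms]
    obtain u where u: "\<And>v. v \<in> range x \<Longrightarrow> 0 \<le> u v" "sum u (range x) = 1"
        "(\<Sum>v\<in>range x. u v *\<^sub>R v) = z"
      using z by (auto simp: convex_hull_finite)
    have sum1: "(\<Sum>j\<in>UNIV. u (x j)) = 1"
      using u(2) by (simp add: sum.reindex[OF inj])
    have "z = (\<Sum>j\<in>UNIV. u (x j) *\<^sub>R x j)"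
      using u(3) by (simp add: sum.reindex[OF inj])
    \<comment> \<open>Polynomials of degree at most one commute with affine combinations, and the
      values at the nodes select the single weight \<open>u (x i)\<close>.\<close>
    then have "lagrange_poly x i z = u (x i)" for i
      using poly_deg_le_one_combination[OF lagrange_poly_properties(1)[OF assms] sum1, of i x]
      by (simp add: lagrange_poly_properties(2)[OF assms] if_distrib cong: if_cong)
    then show ?thesis
      using u(1) sum1 by simp
  qed
  moreover have "x None \<in> convex hull (range x)"
    by (simp add: hull_inc)
  \<comment> \<open>The hull is nonempty, so the image is exactly \<open>{1}\<close> and the maximum
    behind \<open>GREATEST\<close> is attained.\<close>
  ultimately have "(\<lambda>z. \<Sum>i\<in>UNIV. \<bar>lagrange_poly x i z\<bar>) ` (convex hull (range x)) = {1}"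
    by force
  then show ?thesis
    unfolding lebesgue_constant_def by (auto intro!: Greatest_equality)
qed

theorem mainTheorem1:
  fixes V K :: "(real ^ 'n::finite) set"
    and x :: "'n option \<Rightarrow> real ^ 'n"
  assumes "\<not> affine_dependent V"
    and "card V = CARD('n) + 1"
    and "K = convex hull V"
    and "fekete_points x K"
  shows "range x = V \<and> lebesgue_constant x K = 1"
proof -
  have card: "card V = CARD('n option)"
    using assms(2) by (simp add: card_UNIV_option)
  \<comment> \<open>Infinite sets have \<open>card\<close> 0, so a positive cardinality forces
    finiteness.\<close>
  have fin: "finite V"
    using assms(2) card.infinite by fastforce
  obtain v :: "'n option \<Rightarrow> real ^ 'n" where v: "bij_betw v UNIV V"
    using finite_same_card_bij[OF finite_class.finite_UNIV fin card[symmetric]] by blast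
  \<comment> \<open>The vertices compete in the maximization, so their nonzero determinant forces
    \<open>vdm x\<close> to be nonzero; this is where non-degeneracy of the simplex enters.\<close>
  have "vdm v \<noteq> 0"
    using v assms(1) by (intro vdm_nonzero_if_affine_independent) (auto simp: bij_betw_def)
  moreover have max: "\<bar>vdm y\<bar> \<le> \<bar>vdm x\<bar>" if "range y \<subseteq> convex hull V" for y
    using that assms(3,4) by (simp add: fekete_points_def)
  moreover have "range v \<subseteq> convex hull V"
    using v hull_subset[of V convex] by (simp add: bij_betw_def)
  ultimately have nz: "vdm x \<noteq> 0"
    by fastforce
  have range: "range x = V"
    using maximal_vdm_imp_range_eq[OF fin card _ nz max] assms(3,4)
    by (simp add: fekete_points_def)
  then show ?thesis
    using lebesgue_constant_simplex[OF nz] assms(3) by simp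
qed

end
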